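(* For all non-negative integers $n,n',m,m',p,q$ and all complex numbers $z,z',w,w',\gamma$, $$H_{n+n',m}^{(p,q)}(z,w|\gamma)=\sum_{i=0}^{n}\sum_{j=0}^{n'}\binom{n}{i}\binom{n'}{j}(z-z')^{i+j}H_{n+n'-i-j,m}^{(p,q)}(z',w|\gamma),$$ $$H_{n,m+m'}^{(p,q)}(z,w|\gamma)=\sum_{k=0}^{m}\sum_{l=0}^{m'}\binom{m}{k}\binom{m'}{l}(w-w')^{k+l}H_{n,m+m'-k-l}^{(p,q)}(z,w'|\gamma).$$
   Context: For non-negative integers $n,m,p,q$ and complex $z,w,\gamma$, $$H_{n,m}^{(p,q)}(z,w|\gamma)= n!\,m!\sum_{k=0}^{\lfloor n/p\rfloor\wedge\lfloor m/q\rfloor}\frac{\gamma^k}{k!}\frac{z^{n-pk}}{(n-pk)!}\frac{w^{m-qk}}{(m-qk)!},$$ where $a\wedge b=\min\{a,b\}$ and $\lfloor j/0\rfloor=+\infty$ by convention (so for $p=q=0$ the sum is the infinite series $e^{\gamma}z^nw^m$); $0^0=1$. *)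

theory Defs
  imports "HOL-Analysis.Analysis" "HOL-Library.Extended_Nat"
begin

(* The convention j div 0 = \<infinity> replaces the library's j div 0 = 0 on nat. *)
definition floor_div :: "nat \<Rightarrow> nat \<Rightarrow> enat" where
  "floor_div j r = (if r = 0 then \<infinity> else enat (j div r))"

(* infsum is an ordinary finite sum unless p = q = 0, when it is the (absolutely convergent)
   series over all of nat; see the two lemmas below.  In the index set p * k \<le> n and
   q * k \<le> m, so the subtractions on nat do not truncate. *)
definition H :: "nat \<Rightarrow> nat \<Rightarrow> nat \<Rightarrow> nat \<Rightarrow> complex \<Rightarrow> complex \<Rightarrow> complex \<Rightarrow> complex" where
  "H p q n m z w \<gamma> =
     fact n * fact m *
     (\<Sum>\<^sub>\<infinity>k\<in>{k. enat k \<le> min (floor_div n p) (floor_div m q)}.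
        \<gamma> ^ k / fact k * (z ^ (n - p * k) / fact (n - p * k)) * (w ^ (m - q * k) / fact (m - q * k)))"

lemma le_floor_div_iff: "enat k \<le> floor_div j r \<longleftrightarrow> r * k \<le> j"
  by (auto simp: floor_div_def less_eq_div_iff_mult_less_eq mult.commute)

lemma H_finite_sum:
  assumes "p > 0 \<or> q > 0"
  shows "finite {k. p * k \<le> n \<and> q * k \<le> m}"
    and "H p q n m z w \<gamma> =
     fact n * fact m *
     (\<Sum>k | p * k \<le> n \<and> q * k \<le> m.
        \<gamma> ^ k / fact k * (z ^ (n - p * k) / fact (n - p * k)) * (w ^ (m - q * k) / fact (m - q * k)))"
proof -
  have "k \<le> n + m" if "p * k \<le> n" "q * k \<le> m" for k
  proof (cases "p > 0")
    case True
    then have "k \<le> p * k" by simp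
    with that show ?thesis by linarith
  next
    case False
    then have "k \<le> q * k" using assms by simp
    with that show ?thesis by linarith
  qed
  then have "{k. p * k \<le> n \<and> q * k \<le> m} \<subseteq> {..n + m}" by auto
  then show fin: "finite {k. p * k \<le> n \<and> q * k \<le> m}"
    using finite_subset by blast
  show "H p q n m z w \<gamma> =
     fact n * fact m *
     (\<Sum>k | p * k \<le> n \<and> q * k \<le> m.
        \<gamma> ^ k / fact k * (z ^ (n - p * k) / fact (n - p * k)) * (w ^ (m - q * k) / fact (m - q * k)))"
    using fin by (simp add: H_def le_floor_div_iff)
qed

lemma H_0_0: "H 0 0 n m z w \<gamma> = exp \<gamma> * z ^ n * w ^ m"
proof -
  have "summable (\<lambda>k. norm (\<gamma> ^ k / fact k))"
    using summable_norm_exp[of \<gamma>] by (simp add: scaleR_conv_of_real field_simps)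
  moreover have "(\<lambda>k. \<gamma> ^ k / fact k) sums exp \<gamma>"
    using exp_converges[of \<gamma>] by (simp add: scaleR_conv_of_real field_simps)
  ultimately have "((\<lambda>k. \<gamma> ^ k / fact k) has_sum exp \<gamma>) UNIV"
    by (rule norm_summable_imp_has_sum)
  then have "((\<lambda>k. \<gamma> ^ k / fact k * (z ^ n / fact n * (w ^ m / fact m)))
      has_sum (exp \<gamma> * (z ^ n / fact n * (w ^ m / fact m)))) UNIV"
    by (rule has_sum_cmult_left)
  from infsumI[OF this] show ?thesis
    by (simp add: H_def le_floor_div_iff mult.assoc)
qed

end

theory Submission
  imports Defs
begin

text \<open>
  For fixed \<open>k\<close>, the binomial theorem applied to \<open>z = (z - z') + z'\<close> expands the divided power
  \<open>z ^ (N - p k) / (N - p k)!\<close>. Interchanging sums gives the identity with a single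
  increment \<open>N\<close>; Vandermonde's convolution splits it over \<open>N = n + n'\<close>, and the identity in
  the second variable follows from the symmetry exchanging \<open>(p, n, z)\<close> and \<open>(q, m, w)\<close>.
\<close>

text \<open>Pascal's rule tested against a weight \<open>g\<close>; it serves as the induction step
  for Vandermonde's convolution.\<close>

lemma sum_choose_Suc:
  fixes g :: "nat \<Rightarrow> 'a::comm_semiring_1"
  shows "(\<Sum>i\<le>Suc n. of_nat (Suc n choose i) * g i) =
    (\<Sum>i\<le>n. of_nat (n choose i) * (g i + g (Suc i)))"
proof -
  have "(\<Sum>i\<le>Suc n. of_nat (Suc n choose i) * g i) =
      g 0 + (\<Sum>i\<le>n. of_nat (n choose Suc i) * g (Suc i)) + (\<Sum>i\<le>n. of_nat (n choose i) * g (Suc i))"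
    by (simp add: sum.atMost_Suc_shift sum.distrib algebra_simps del: sum.atMost_Suc)
  also have "g 0 + (\<Sum>i\<le>n. of_nat (n choose Suc i) * g (Suc i)) =
      (\<Sum>i\<le>Suc n. of_nat (n choose i) * g i)"
    by (simp add: sum.atMost_Suc_shift del: sum.atMost_Suc)
  \<comment> \<open>The top term vanishes because \<open>n choose Suc n\<close> is 0.\<close>
  also have "\<dots> = (\<Sum>i\<le>n. of_nat (n choose i) * g i)"
    by (simp add: binomial_eq_0)
  finally show ?thesis
    by (simp add: sum.distrib distrib_left)
qed

text \<open>Vandermonde's convolution tested against \<open>f\<close>. The induction needs
  \<open>f\<close> arbitrary, since each use of Pascal's rule replaces \<open>f s\<close> by
  \<open>f s + f (Suc s)\<close>.\<close>

lemma vandermonde_sum: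
  fixes f :: "nat \<Rightarrow> 'a::comm_semiring_1"
  shows "(\<Sum>i\<le>n. \<Sum>j\<le>n'. of_nat (n choose i) * of_nat (n' choose j) * f (i + j)) =
    (\<Sum>s\<le>n + n'. of_nat ((n + n') choose s) * f s)"
proof (induction n arbitrary: f)
  case 0
  then show ?case by simp
next
  case (Suc n)
  have "(\<Sum>i\<le>Suc n. \<Sum>j\<le>n'. of_nat (Suc n choose i) * of_nat (n' choose j) * f (i + j)) =
      (\<Sum>i\<le>n. \<Sum>j\<le>n'. of_nat (n choose i) * of_nat (n' choose j) * (f (i + j) + f (Suc (i + j))))"
    using sum_choose_Suc[of n "\<lambda>i. \<Sum>j\<le>n'. of_nat (n' choose j) * f (i + j)"]
    by (simp only: sum_distrib_left mult.assoc sum.distrib[symmetric] distrib_left add_Suc)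
  then show ?case
    \<comment> \<open>Pascal's rule at \<open>n + n'\<close> turns the right-hand side into the same
      shifted sum.\<close>
    by (simp only: Suc.IH[of "\<lambda>s. f s + f (Suc s)"] add_Suc sum_choose_Suc)
qed

lemma binomial_divided_power:
  fixes x y :: "'a::field_char_0"
  shows "(x + y) ^ n / fact n = (\<Sum>s\<le>n. x ^ s / fact s * (y ^ (n - s) / fact (n - s)))"
  by (simp add: binomial_ring sum_divide_distrib binomial_fact field_simps)

text \<open>After division by \<open>fact N\<close> this is a convolution with the divided powers of
  \<open>z - z'\<close>.\<close>

lemma H_shift:
  "H p q N m z w \<gamma> =
    (\<Sum>s\<le>N. of_nat (N choose s) * ((z - z') ^ s * H p q (N - s) m z' w \<gamma>))"
\<comment> \<open>For \<open>p = q = 0\<close> the series is infinite and a finite interchange does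
  not apply; the closed form \<open>H_0_0\<close> reduces the claim to the binomial theorem.\<close>
proof (cases "p = 0 \<and> q = 0")
  case True
  have "z ^ N = (\<Sum>s\<le>N. of_nat (N choose s) * (z - z') ^ s * z' ^ (N - s))"
    using binomial_ring[of "z - z'" z' N] by simp
  with True show ?thesis
    by (simp add: H_0_0 sum_distrib_left sum_distrib_right mult_ac)
next
  case False
  then have pq: "p > 0 \<or> q > 0" by simp
  define A where "A N = {k. p * k \<le> N \<and> q * k \<le> m}" for N
  define c where "c k = \<gamma> ^ k / fact k * (w ^ (m - q * k) / fact (m - q * k))" for k
  have fin: "finite (A N)" for N
    using H_finite_sum(1)[OF pq] by (simp add: A_def)
  have H: "H p q N m z w \<gamma> =
      fact N * fact m * (\<Sum>k\<in>A N. c k * (z ^ (N - p * k) / fact (N - p * k)))" for N z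
    unfolding H_finite_sum(2)[OF pq] A_def c_def by (simp add: mult_ac)
  \<comment> \<open>For \<open>k \<in> A N\<close> the guard \<open>k \<in> A (N - s)\<close> means
    \<open>s \<le> N - p * k\<close>, the range of the binomial expansion; after the interchange it
    gives the index set of \<open>H\<close> at \<open>N - s\<close>.\<close>
  have "(\<Sum>k\<in>A N. c k * (z ^ (N - p * k) / fact (N - p * k))) =
      (\<Sum>k\<in>A N. \<Sum>s | s \<le> N \<and> k \<in> A (N - s).
        (z - z') ^ s / fact s * (c k * (z' ^ (N - s - p * k) / fact (N - s - p * k))))"
  proof (rule sum.cong[OF refl])
    fix k assume "k \<in> A N"
    then have "{s. s \<le> N \<and> k \<in> A (N - s)} = {..N - p * k}"
      by (auto simp: A_def)
    then show "c k * (z ^ (N - p * k) / fact (N - p * k)) =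
      (\<Sum>s | s \<le> N \<and> k \<in> A (N - s).
        (z - z') ^ s / fact s * (c k * (z' ^ (N - s - p * k) / fact (N - s - p * k))))"
      using binomial_divided_power[of "z - z'" z' "N - p * k"]
      by (simp add: sum_distrib_left mult_ac diff_right_commute add.commute)
  qed
  also have "\<dots> = (\<Sum>s\<le>N. \<Sum>k | k \<in> A N \<and> k \<in> A (N - s).
        (z - z') ^ s / fact s * (c k * (z' ^ (N - s - p * k) / fact (N - s - p * k))))"
    using sum.swap_restrict[OF fin[of N] finite_atMost[of N],
      of "\<lambda>k s. (z - z') ^ s / fact s * (c k * (z' ^ (N - s - p * k) / fact (N - s - p * k)))"
         "\<lambda>k s. k \<in> A (N - s)"]
    by simp
  also have "\<dots> = (\<Sum>s\<le>N. (z - z') ^ s / fact s *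
      (\<Sum>k\<in>A (N - s). c k * (z' ^ (N - s - p * k) / fact (N - s - p * k))))"
  proof -
    \<comment> \<open>\<open>A\<close> is monotone in its argument.\<close>
    have "{k. k \<in> A N \<and> k \<in> A (N - s)} = A (N - s)" for s
      by (auto simp: A_def)
    then show ?thesis by (simp add: sum_distrib_left)
  qed
  \<comment> \<open>The prefactor of \<open>H\<close> at \<open>N - s\<close> comes from
    \<open>fact N / fact s = (N choose s) * fact (N - s)\<close>.\<close>
  finally show ?thesis
    by (simp add: H sum_distrib_left binomial_fact mult_ac)
qed

lemma H_swap: "H p q n m z w \<gamma> = H q p m n w z \<gamma>"
  by (simp add: H_def min.commute mult_ac)

lemma H_add:
  "H p q (n + n') m z w \<gamma> =
    (\<Sum>i=0..n. \<Sum>j=0..n'. of_nat (n choose i) * of_nat (n' choose j) *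
      (z - z') ^ (i + j) * H p q (n + n' - i - j) m z' w \<gamma>)"
  using H_shift[of p q "n + n'" m z w \<gamma> z']
    vandermonde_sum[of n n' "\<lambda>s. (z - z') ^ s * H p q (n + n' - s) m z' w \<gamma>"]
  by (simp add: atLeast0AtMost mult.assoc)

theorem theorem7p1:
  fixes n n' m m' p q :: nat and z z' w w' \<gamma> :: complex
  shows "H p q (n + n') m z w \<gamma> =
           (\<Sum>i=0..n. \<Sum>j=0..n'. of_nat (n choose i) * of_nat (n' choose j) *
              (z - z') ^ (i + j) * H p q (n + n' - i - j) m z' w \<gamma>)
       \<and> H p q n (m + m') z w \<gamma> =
           (\<Sum>k=0..m. \<Sum>l=0..m'. of_nat (m choose k) * of_nat (m' choose l) *
              (w - w') ^ (k + l) * H p q n (m + m' - k - l) z w' \<gamma>)"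
  \<comment> \<open>Fixing \<open>p q n\<close> in \<open>H_swap\<close> orients the rewriting and
    leaves the first conjunct untouched.\<close>
  using H_add H_swap[of p q n] H_add[of q p m m' n w z \<gamma> w'] by simp

end
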